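(* The set $\mathfrak B=\{A\{\lambda\}\mid A\in\Theta^\pm_\triangle(n),\ \lambda\in\mathbb N^n_\triangle\}$ forms a $\mathbb Z$-basis of $\mathcal V_{\mathbb Z}(n)$, the $\mathbb Z$-submodule of $\widehat{\mathcal K}_{\mathbb Q}(n)$ spanned by $\mathfrak B$ (here the elements $A\{\lambda\}$ are indexed by the pairs $(A,\lambda)$).
   Context: Matrices. Let $n\ge2$ be an integer, $\mathbb N=\{0,1,2,\dots\}$. $M_{\triangle,n}(\mathbb Z)$ is the set of integer matrices $A=(a_{i,j})_{i,j\in\mathbb Z}$ with $a_{i,j}=a_{i+n,j+n}$ and with finitely many nonzero entries in every row and column. $\widetilde\Theta_\triangle(n)=\{A\in M_{\triangle,n}(\mathbb Z): a_{i,j}\ge0\ \forall i\ne j\}$; $\Theta_\triangle(n)$ is the subset of matrices with all entries in $\mathbb N$; $\Theta^\pm_\triangle(n)=\{A\in\Theta_\triangle(n):a_{i,i}=0\ \forall i\}$. $\mathbb Z^n_\triangle$ is the set of $n$-periodic integer sequences $(\lambda_i)_{i\in\mathbb Z}$ (identified with $\mathbb Z^n$), $\mathbb N^n_\triangle$ its subset of nonnegative sequences. $\sigma(\lambda)=\sum_{i=1}^n\lambda_i$, $\sigma(A)=\sum_{1\le i\le n,\,j\in\mathbb Z}a_{i,j}$, $\Lambda_\triangle(n,r)=\{\lambda\in\mathbb N^n_\triangle:\sigma(\lambda)=r\}$, $\Theta_\triangle(n,r)=\{A\in\Theta_\triangle(n):\sigma(A)=r\}$. $\mathrm{ro}(A)=(\sum_ja_{i,j})_i$,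 $\mathrm{co}(A)=(\sum_ia_{i,j})_j$; $\mathrm{diag}(\lambda)$ is the diagonal matrix with diagonal $\lambda$; ${}_aA=A+aI$. Affine Schur algebras. Let $r\ge0$. $\mathfrak S_{\triangle,r}$ is the group of permutations $w$ of $\mathbb Z$ with $w(i+r)=w(i)+r$ for all $i$ (the trivial group if $r=0$). $W$ is the subgroup of those $w$ with $\sum_{i=1}^rw(i)=\sum_{i=1}^ri$; it is the affine Weyl group of type $A$ with simple reflections $s_i$ ($1\le i\le r$), $s_i(j)=j+1$ if $j\equiv i$, $j-1$ if $j\equiv i+1$, and $j$ otherwise (mod $r$) ($W$ is trivial if $r\le1$). Let $\rho(j)=j+1$; then $\mathfrak S_{\triangle,r}=\langle\rho\rangle\ltimes W$ and the length function $\ell$ of $W$ is extended by $\ell(\rho^mw)=\ell(w)$. $s_1,\dots,s_{r-1}$ generate the symmetric group $\mathfrak S_r$. Let $\mathcal Z=\mathbb Z[v,v^{-1}]$. The extended affine Hecke algebra $\mathcal H_\triangle(r)$ is the $\mathcal Z$-algebra with basis $\{T_w\}_{w\in\mathfrak S_{\triangle,r}}$ and relations $T_{s_i}^2=(v^2-1)T_{s_i}+v^2$, and $T_wT_{w'}=T_{ww'}$ if $\ell(ww')=\ell(w)+\ell(w')$. For $\lambda\in\Lambda_\triangle(n,r)$ let $\mathfrak S_\lambda\subseteq\mathfrak S_r$ be the standard Young subgroup of $(\lambda_1,\dots,\lambda_n)$, $x_\lambda=\sum_{w\in\mathfrak S_\lambda}T_w$, and $\mathcal S_\triangle(n,r)=\mathrm{End}_{\mathcal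 H_\triangle(r)}\big(\bigoplus_{\lambda\in\Lambda_\triangle(n,r)}x_\lambda\mathcal H_\triangle(r)\big)$. Let $\mathscr D_\lambda=\{d:\ell(wd)=\ell(w)+\ell(d)\ \forall w\in\mathfrak S_\lambda\}$ and $\mathscr D_{\lambda,\mu}=\mathscr D_\lambda\cap\mathscr D_\mu^{-1}$. For $d\in\mathscr D_{\lambda,\mu}$ define $\phi^d_{\lambda,\mu}(x_\nu h)=\delta_{\mu\nu}\sum_{w\in\mathfrak S_\lambda d\mathfrak S_\mu}T_wh$; these form a $\mathcal Z$-basis of $\mathcal S_\triangle(n,r)$. Put $R^\lambda_{i+kn}=\{\lambda_{k,i-1}+1,\dots,\lambda_{k,i-1}+\lambda_i\}$, $\lambda_{k,i-1}=kr+\sum_{1\le t\le i-1}\lambda_t$ ($1\le i\le n$, $k\in\mathbb Z$). The map $(\lambda,d,\mu)\mapsto A=(|R^\lambda_k\cap dR^\mu_l|)_{k,l}$ is a bijection from triples with $\lambda,\mu\in\Lambda_\triangle(n,r)$, $d\in\mathscr D_{\lambda,\mu}$ onto $\Theta_\triangle(n,r)$; write $e_A=\phi^d_{\lambda,\mu}$ and $[A]=v^{-d_A}e_A$ with $d_A=\sum_{1\le i\le n,\ i\ge k,\ j<l}a_{i,j}a_{k,l}$. $\mathcal S_\triangle(n,r)_{\mathbb Z}$ is the specialization at $v=1$ over $\mathbb Z$, with basis $[A]_1=[A]\otimes1$, $A\in\Theta_\triangle(n,r)$. If $\sigma(A)=r$ and some $a_{i,i}<0$, put $[A]_1=0$ there.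 The algebra $\mathcal K_{\mathbb Z}(n)$. $\mathcal Z_1\subset\mathbb Q[x]$ is the subring generated by $1$ and all $\binom{a+x}{t}$ ($a\in\mathbb Z,t\in\mathbb N$). For $A,B\in\widetilde\Theta_\triangle(n)$ with $\mathrm{co}(B)=\mathrm{ro}(A)$ there are unique $X_i\in\widetilde\Theta_\triangle(n)$ and $P_i\in\mathcal Z_1$ with $[{}_aB]_1[{}_aA]_1=\sum_iP_i(a)[{}_aX_i]_1$ in $\mathcal S_\triangle(n,an+\sigma(A))_{\mathbb Z}$ for all large $a$. Let $\widetilde{\mathcal K}(n)$ be the free $\mathcal Z_1$-module on $\widetilde\Theta_\triangle(n)$ with the associative product $B\cdot A=\sum_iP_i(x)X_i$ if $\mathrm{co}(B)=\mathrm{ro}(A)$ and $B\cdot A=0$ otherwise. $\mathcal K_{\mathbb Z}(n)=\widetilde{\mathcal K}(n)\otimes_{\mathcal Z_1}\mathbb Z$ via $x\mapsto0$, with $\mathbb Z$-basis $[A]_1:=A\otimes1$. $\widehat{\mathcal K}_{\mathbb Q}(n)$ is the algebra of formal, possibly infinite, sums $\sum_{A\in\widetilde\Theta_\triangle(n)}\beta_A[A]_1$ ($\beta_A\in\mathbb Q$) such that for each $\mathbf x\in\mathbb Z^n$ the sets $\{A:\beta_A\ne0,\mathrm{ro}(A)=\mathbf x\}$ and $\{A:\beta_A\neq0,\mathrm{co}(A)=\mathbf x\}$ are finite, with product extending that of $\mathcal K_{\mathbb Z}(n)$. Special elements. $\binom mt=m(m-1)\cdots(m-t+1)/t!$ for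 $m\in\mathbb Z$, $t\in\mathbb N$, and $\binom\mu\lambda=\prod_{i=1}^n\binom{\mu_i}{\lambda_i}$. For $A\in\Theta^\pm_\triangle(n)$, $\lambda\in\mathbb N^n_\triangle$: $A\{\lambda\}=\sum_{\mu\in\mathbb Z^n_\triangle}\binom\mu\lambda[A+\mathrm{diag}(\mu)]_1\in\widehat{\mathcal K}_{\mathbb Q}(n)$. *)

theory Defs
  imports
    "HOL-Library.Poly_Mapping"
    "HOL-Library.FuncSet"
    "HOL-Number_Theory.Cong"
    "HOL-Computational_Algebra.Polynomial"
    "HOL-Algebra.Module"
    "HOL-Algebra.Generated_Groups"
begin

section \<open>Periodic sequences and matrices\<close>

type_synonym seq = "int \<Rightarrow> int"
type_synonym matrix = "int \<Rightarrow> int \<Rightarrow> int"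

definition Zseq :: "nat \<Rightarrow> seq set" where
  "Zseq n = {l. \<forall>i. l (i + int n) = l i}"

definition Nseq :: "nat \<Rightarrow> seq set" where
  "Nseq n = {l \<in> Zseq n. \<forall>i. 0 \<le> l i}"

definition seq_sum :: "nat \<Rightarrow> seq \<Rightarrow> int" where
  "seq_sum n l = (\<Sum>i = 1..int n. l i)"

definition Lam :: "nat \<Rightarrow> nat \<Rightarrow> seq set" where
  "Lam n r = {l \<in> Nseq n. seq_sum n l = int r}"

definition affine_matrices :: "nat \<Rightarrow> matrix set" where
  "affine_matrices n = {A. (\<forall>i j. A (i + int n) (j + int n) = A i j) \<and>
     (\<forall>i. finite {j. A i j \<noteq> 0}) \<and> (\<forall>j. finite {i. A i j \<noteq> 0})}"

definition Theta_tilde :: "nat \<Rightarrow> matrix set" where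
  "Theta_tilde n = {A \<in> affine_matrices n. \<forall>i j. i \<noteq> j \<longrightarrow> 0 \<le> A i j}"

definition Theta :: "nat \<Rightarrow> matrix set" where
  "Theta n = {A \<in> affine_matrices n. \<forall>i j. 0 \<le> A i j}"

definition Theta_pm :: "nat \<Rightarrow> matrix set" where
  "Theta_pm n = {A \<in> Theta n. \<forall>i. A i i = 0}"

definition mat_sum :: "nat \<Rightarrow> matrix \<Rightarrow> int" where
  "mat_sum n A = (\<Sum>(i, j) | 1 \<le> i \<and> i \<le> int n \<and> A i j \<noteq> 0. A i j)"

definition Theta_r :: "nat \<Rightarrow> nat \<Rightarrow> matrix set" where
  "Theta_r n r = {A \<in> Theta n. mat_sum n A = int r}"

definition ro :: "matrix \<Rightarrow> seq" where
  "ro A = (\<lambda>i. \<Sum>j | A i j \<noteq> 0. A i j)"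

definition co :: "matrix \<Rightarrow> seq" where
  "co A = (\<lambda>j. \<Sum>i | A i j \<noteq> 0. A i j)"

definition diag_mat :: "seq \<Rightarrow> matrix" where
  "diag_mat l = (\<lambda>i j. if i = j then l i else 0)"

definition mat_add :: "matrix \<Rightarrow> matrix \<Rightarrow> matrix" where
  "mat_add A B = (\<lambda>i j. A i j + B i j)"

definition shift_mat :: "nat \<Rightarrow> matrix \<Rightarrow> matrix" where
  "shift_mat a A = mat_add A (diag_mat (\<lambda>_. int a))"


section \<open>The extended affine symmetric group\<close>

text \<open>The group operation is composition of functions. The case of parameter 0 has to be
  singled out, because the periodicity condition is then void.\<close>

definition affine_sym :: "nat \<Rightarrow> (int \<Rightarrow> int) set" where
  "affine_sym r = (if r = 0 then {id} else {w. bij w \<and> (\<forall>i. w (i + int r) = w i + int r)})"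

definition affine_weyl :: "nat \<Rightarrow> (int \<Rightarrow> int) set" where
  "affine_weyl r = {w \<in> affine_sym r. (\<Sum>i = 1..int r. w i) = (\<Sum>i = 1..int r. i)}"

definition simple_reflection :: "nat \<Rightarrow> int \<Rightarrow> int \<Rightarrow> int" where
  "simple_reflection r i = (\<lambda>j. if [j = i] (mod int r) then j + 1
     else if [j = i + 1] (mod int r) then j - 1 else j)"

text \<open>There are no simple reflections if \<open>r \<le> 1\<close>.\<close>

definition simple_index :: "nat \<Rightarrow> int set" where
  "simple_index r = (if 2 \<le> r then {1..int r} else {})"

definition weyl_length :: "nat \<Rightarrow> (int \<Rightarrow> int) \<Rightarrow> nat" where
  "weyl_length r w = (LEAST k. \<exists>js. length js = k \<and> set js \<subseteq> simple_index r \<and>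
     w = foldr (\<circ>) (map (simple_reflection r) js) id)"

text \<open>The translation \<open>\<lambda>j. j + m\<close> is the \<open>m\<close>-th power of \<open>\<rho>\<close>.\<close>

definition affine_length :: "nat \<Rightarrow> (int \<Rightarrow> int) \<Rightarrow> nat" where
  "affine_length r u = (THE k. \<exists>m. \<exists>w \<in> affine_weyl r.
     u = (\<lambda>j. j + m) \<circ> w \<and> k = weyl_length r w)"


section \<open>The extended affine Hecke algebra\<close>

text \<open>With the convolution product, \<open>int \<Rightarrow>\<^sub>0 int\<close> is the ring of integral Laurent polynomials.\<close>

type_synonym laurent = "int \<Rightarrow>\<^sub>0 int"
type_synonym hecke = "(int \<Rightarrow> int) \<Rightarrow>\<^sub>0 laurent"

definition vpow :: "int \<Rightarrow> laurent" where
  "vpow k = Poly_Mapping.single k 1"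

definition at_one :: "laurent \<Rightarrow> int" where
  "at_one p = (\<Sum>k \<in> Poly_Mapping.keys p. Poly_Mapping.lookup p k)"

definition scale :: "laurent \<Rightarrow> hecke \<Rightarrow> hecke" where
  "scale c h = Poly_Mapping.map ((*) c) h"

definition T :: "(int \<Rightarrow> int) \<Rightarrow> hecke" where
  "T w = Poly_Mapping.single w 1"

definition hecke_carrier :: "nat \<Rightarrow> hecke set" where
  "hecke_carrier r = {h. Poly_Mapping.keys h \<subseteq> affine_sym r}"

definition is_hecke_mult :: "nat \<Rightarrow> (hecke \<Rightarrow> hecke \<Rightarrow> hecke) \<Rightarrow> bool" where
  "is_hecke_mult r m \<longleftrightarrow>
     (let H = hecke_carrier r in
      (\<forall>g\<in>H. \<forall>h\<in>H. m g h \<in> H) \<and>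
      (\<forall>f\<in>H. \<forall>g\<in>H. \<forall>h\<in>H. m (f + g) h = m f h + m g h \<and> m f (g + h) = m f g + m f h) \<and>
      (\<forall>c. \<forall>g\<in>H. \<forall>h\<in>H. m (scale c g) h = scale c (m g h) \<and> m g (scale c h) = scale c (m g h)) \<and>
      (\<forall>f\<in>H. \<forall>g\<in>H. \<forall>h\<in>H. m (m f g) h = m f (m g h)) \<and>
      (\<forall>h\<in>H. m (T id) h = h \<and> m h (T id) = h)) \<and>
     (\<forall>i\<in>simple_index r. m (T (simple_reflection r i)) (T (simple_reflection r i)) =
        scale (vpow 2 - 1) (T (simple_reflection r i)) + scale (vpow 2) (T id)) \<and>
     (\<forall>w\<in>affine_sym r. \<forall>w'\<in>affine_sym r.
        affine_length r (w \<circ> w') = affine_length r w + affine_length r w' \<longrightarrow>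
        m (T w) (T w') = T (w \<circ> w'))"

text \<open>The relations determine the product on \<^const>\<open>hecke_carrier\<close>; the values outside are
  irrelevant.\<close>

definition hecke_mult :: "nat \<Rightarrow> hecke \<Rightarrow> hecke \<Rightarrow> hecke" where
  "hecke_mult r = (SOME m. is_hecke_mult r m)"


section \<open>The affine Schur algebra\<close>

text \<open>Every integer index is written as \<open>i + k * n\<close> with \<open>1 \<le> i \<le> n\<close>.\<close>

definition block :: "nat \<Rightarrow> nat \<Rightarrow> seq \<Rightarrow> int \<Rightarrow> int set" where
  "block n r l q =
     (let i = (q - 1) mod int n + 1; k = (q - 1) div int n;
          s = k * int r + (\<Sum>t = 1..i - 1. l t)
      in {s + 1..s + l i})"

definition young :: "nat \<Rightarrow> nat \<Rightarrow> seq \<Rightarrow> (int \<Rightarrow> int) set" where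
  "young n r l = {w \<in> affine_sym r. \<forall>i \<in> {1..int n}. w ` block n r l i = block n r l i}"

definition x_elt :: "nat \<Rightarrow> nat \<Rightarrow> seq \<Rightarrow> hecke" where
  "x_elt n r l = (\<Sum>w \<in> young n r l. T w)"

definition young_reps :: "nat \<Rightarrow> nat \<Rightarrow> seq \<Rightarrow> (int \<Rightarrow> int) set" where
  "young_reps n r l = {d \<in> affine_sym r. \<forall>w \<in> young n r l.
     affine_length r (w \<circ> d) = affine_length r w + affine_length r d}"

definition young_double_reps :: "nat \<Rightarrow> nat \<Rightarrow> seq \<Rightarrow> seq \<Rightarrow> (int \<Rightarrow> int) set" where
  "young_double_reps n r l m = {d \<in> young_reps n r l. inv_into UNIV d \<in> young_reps n r m}"

text \<open>Elements of the direct sum of the right ideals generated by the \<^const>\<open>x_elt\<close> are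
  families indexed by the finite set \<^const>\<open>Lam\<close>, extended by zero.\<close>

type_synonym tens = "seq \<Rightarrow> hecke"

definition tensor_space :: "nat \<Rightarrow> nat \<Rightarrow> tens set" where
  "tensor_space n r = {z. (\<forall>l \<in> Lam n r. z l \<in> hecke_mult r (x_elt n r l) ` hecke_carrier r) \<and>
     (\<forall>l. l \<notin> Lam n r \<longrightarrow> z l = 0)}"

definition summand :: "seq \<Rightarrow> hecke \<Rightarrow> tens" where
  "summand l h = (\<lambda>k. if k = l then h else 0)"

definition schur_algebra :: "nat \<Rightarrow> nat \<Rightarrow> (tens \<Rightarrow> tens) set" where
  "schur_algebra n r = {f \<in> tensor_space n r \<rightarrow>\<^sub>E tensor_space n r.
     (\<forall>y \<in> tensor_space n r. \<forall>z \<in> tensor_space n r. f (\<lambda>l. y l + z l) = (\<lambda>l. f y l + f z l)) \<and>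
     (\<forall>z \<in> tensor_space n r. \<forall>h \<in> hecke_carrier r.
        f (\<lambda>l. hecke_mult r (z l) h) = (\<lambda>l. hecke_mult r (f z l) h))}"

definition phi :: "nat \<Rightarrow> nat \<Rightarrow> seq \<Rightarrow> (int \<Rightarrow> int) \<Rightarrow> seq \<Rightarrow> tens \<Rightarrow> tens" where
  "phi n r l d m = (THE f. f \<in> schur_algebra n r \<and>
     (\<forall>k \<in> Lam n r. \<forall>h \<in> hecke_carrier r.
        f (summand k (hecke_mult r (x_elt n r k) h)) =
          (if k = m
           then summand l (\<Sum>w \<in> {u \<circ> d \<circ> u' | u u'. u \<in> young n r l \<and> u' \<in> young n r m}.
                             hecke_mult r (T w) h)
           else (\<lambda>_. 0))))"

definition coset_matrix :: "nat \<Rightarrow> nat \<Rightarrow> seq \<Rightarrow> (int \<Rightarrow> int) \<Rightarrow> seq \<Rightarrow> matrix" where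
  "coset_matrix n r l d m = (\<lambda>p q. int (card (block n r l p \<inter> d ` block n r m q)))"

definition e_elt :: "nat \<Rightarrow> nat \<Rightarrow> matrix \<Rightarrow> tens \<Rightarrow> tens" where
  "e_elt n r A = (THE f. \<exists>l \<in> Lam n r. \<exists>m \<in> Lam n r. \<exists>d \<in> young_double_reps n r l m.
     coset_matrix n r l d m = A \<and> f = phi n r l d m)"

definition d_exp :: "nat \<Rightarrow> matrix \<Rightarrow> int" where
  "d_exp n A = (\<Sum>(i, j, k, l) | 1 \<le> i \<and> i \<le> int n \<and> i \<ge> k \<and> j < l \<and> A i j * A k l \<noteq> 0.
     A i j * A k l)"

definition schur_basis :: "nat \<Rightarrow> nat \<Rightarrow> matrix \<Rightarrow> tens \<Rightarrow> tens" where
  "schur_basis n r A = (\<lambda>z \<in> tensor_space n r. \<lambda>l. scale (vpow (- d_exp n A)) (e_elt n r A z l))"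

definition schur_struct :: "nat \<Rightarrow> nat \<Rightarrow> matrix \<Rightarrow> matrix \<Rightarrow> (matrix \<Rightarrow>\<^sub>0 laurent)" where
  "schur_struct n r B A = (THE g. Poly_Mapping.keys g \<subseteq> Theta_r n r \<and>
     (\<forall>z \<in> tensor_space n r. \<forall>l. schur_basis n r B (schur_basis n r A z) l =
        (\<Sum>C \<in> Poly_Mapping.keys g. scale (Poly_Mapping.lookup g C) (schur_basis n r C z l))))"

text \<open>The specialization at \<open>v = 1\<close> is the free abelian group on \<^const>\<open>Theta_r\<close> with the
  specialized structure constants.\<close>

definition schur1_basis :: "nat \<Rightarrow> nat \<Rightarrow> matrix \<Rightarrow> (matrix \<Rightarrow>\<^sub>0 int)" where
  "schur1_basis n r A = (if A \<in> Theta_r n r then Poly_Mapping.single A 1 else 0)"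

definition schur1_mult ::
    "nat \<Rightarrow> nat \<Rightarrow> (matrix \<Rightarrow>\<^sub>0 int) \<Rightarrow> (matrix \<Rightarrow>\<^sub>0 int) \<Rightarrow> (matrix \<Rightarrow>\<^sub>0 int)" where
  "schur1_mult n r y z = (\<Sum>B \<in> Poly_Mapping.keys y. \<Sum>A \<in> Poly_Mapping.keys z.
     Poly_Mapping.map (\<lambda>p. Poly_Mapping.lookup y B * Poly_Mapping.lookup z A * at_one p)
       (schur_struct n r B A))"


section \<open>Stabilization and completion\<close>

definition binom_poly :: "int \<Rightarrow> nat \<Rightarrow> rat poly" where
  "binom_poly a t = Polynomial.smult (1 / fact t) (\<Prod>i<t. [:of_int a - of_nat i, 1:])"

inductive_set Z1 :: "rat poly set" where
  one: "1 \<in> Z1"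
| binom: "binom_poly a t \<in> Z1"
| diff: "p \<in> Z1 \<Longrightarrow> q \<in> Z1 \<Longrightarrow> p - q \<in> Z1"
| mult: "p \<in> Z1 \<Longrightarrow> q \<in> Z1 \<Longrightarrow> p * q \<in> Z1"

text \<open>The product of two basis elements in the free \<^const>\<open>Z1\<close>-module on \<^const>\<open>Theta_tilde\<close>.
  The condition on \<^const>\<open>mat_sum\<close> says that the stabilized matrices live in the same Schur
  algebra as the two factors; since the matrices are periodic, \<open>co B = ro A\<close> forces
  \<open>mat_sum n B = mat_sum n A\<close>. For large \<open>a\<close> the argument of \<^const>\<open>nat\<close> is nonnegative.\<close>

definition Ktilde_prod :: "nat \<Rightarrow> matrix \<Rightarrow> matrix \<Rightarrow> (matrix \<Rightarrow>\<^sub>0 rat poly)" where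
  "Ktilde_prod n B A =
     (if co B = ro A then
        (THE P. Poly_Mapping.keys P \<subseteq> {X \<in> Theta_tilde n. mat_sum n X = mat_sum n A} \<and>
           (\<forall>X \<in> Poly_Mapping.keys P. Poly_Mapping.lookup P X \<in> Z1) \<and>
           (\<exists>N. \<forall>a\<ge>N. let r = nat (int a * int n + mat_sum n A) in
              \<forall>C. of_int (Poly_Mapping.lookup (schur1_mult n r (schur1_basis n r (shift_mat a B))
                                               (schur1_basis n r (shift_mat a A))) C) =
                  (\<Sum>X \<in> Poly_Mapping.keys P. poly (Poly_Mapping.lookup P X) (of_nat a) *
                                  of_int (Poly_Mapping.lookup (schur1_basis n r (shift_mat a X)) C))))
      else 0)"

text \<open>The structure constants after the specialization \<open>x \<mapsto> 0\<close>; they are integers.\<close>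

definition K_struct :: "nat \<Rightarrow> matrix \<Rightarrow> matrix \<Rightarrow> matrix \<Rightarrow> rat" where
  "K_struct n B A X = poly (Poly_Mapping.lookup (Ktilde_prod n B A) X) 0"

text \<open>Formal sums are given by their coefficient functions. In the product, only finitely many
  pairs contribute to each coefficient, by the finiteness conditions on the carrier.\<close>

definition Khat :: "nat \<Rightarrow> (rat, matrix \<Rightarrow> rat) module" where
  "Khat n = \<lparr>
     carrier = {\<beta>. (\<forall>A. \<beta> A \<noteq> 0 \<longrightarrow> A \<in> Theta_tilde n) \<and>
        (\<forall>x \<in> Zseq n. finite {A. \<beta> A \<noteq> 0 \<and> ro A = x} \<and> finite {A. \<beta> A \<noteq> 0 \<and> co A = x})},
     monoid.mult = (\<lambda>\<beta> \<gamma> C. \<Sum>(B, A) | \<beta> B \<noteq> 0 \<and> \<gamma> A \<noteq> 0 \<and> K_struct n B A C \<noteq> 0.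
        \<beta> B * \<gamma> A * K_struct n B A C),
     one = (\<lambda>A. if \<exists>l \<in> Zseq n. A = diag_mat l then 1 else 0),
     zero = (\<lambda>A. 0),
     add = (\<lambda>\<beta> \<gamma> A. \<beta> A + \<gamma> A),
     smult = (\<lambda>c \<beta> A. c * \<beta> A) \<rparr>"


section \<open>The elements \<open>A{\<lambda>}\<close> and their integral span\<close>

definition binom_seq :: "nat \<Rightarrow> seq \<Rightarrow> seq \<Rightarrow> rat" where
  "binom_seq n m l = (\<Prod>i = 1..int n. of_int (m i) gchoose nat (l i))"

text \<open>The coefficient at \<open>X\<close> of the formal sum over all \<open>m \<in> Zseq n\<close>; at most one \<open>m\<close>
  contributes to it.\<close>

definition brace :: "nat \<Rightarrow> matrix \<Rightarrow> seq \<Rightarrow> (matrix \<Rightarrow> rat)" where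
  "brace n A l = (\<lambda>X. \<Sum>m | m \<in> Zseq n \<and> mat_add A (diag_mat m) = X. binom_seq n m l)"

definition B_set :: "nat \<Rightarrow> (matrix \<Rightarrow> rat) set" where
  "B_set n = {brace n A l | A l. A \<in> Theta_pm n \<and> l \<in> Nseq n}"

text \<open>The \<open>\<int>\<close>-submodule spanned by a subset is the subgroup generated by it in the
  additive group.\<close>

definition V_Z :: "nat \<Rightarrow> (matrix \<Rightarrow> rat) set" where
  "V_Z n = generate (add_monoid (Khat n)) (B_set n)"

definition Z_basis :: "('a, 'm) ring_scheme \<Rightarrow> ('i \<Rightarrow> 'a) \<Rightarrow> 'i set \<Rightarrow> 'a set \<Rightarrow> bool" where
  "Z_basis G b I V \<longleftrightarrow> b \<in> I \<rightarrow> V \<and>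
     (\<forall>F (c :: 'i \<Rightarrow> int). finite F \<and> F \<subseteq> I \<and>
        (\<Oplus>\<^bsub>G\<^esub>i\<in>F. [c i] \<cdot>\<^bsub>G\<^esub> b i) = \<zero>\<^bsub>G\<^esub> \<longrightarrow> (\<forall>i\<in>F. c i = 0)) \<and>
     (\<forall>v\<in>V. \<exists>F (c :: 'i \<Rightarrow> int). finite F \<and> F \<subseteq> I \<and> v = (\<Oplus>\<^bsub>G\<^esub>i\<in>F. [c i] \<cdot>\<^bsub>G\<^esub> b i))"

end

theory Submission
  imports Defs
begin

text \<open>
  In the group \<^term>\<open>Khat n\<close> of formal sums, addition and integer multiples are computed
  coefficientwise (\<open>Khat_int_combination\<close>). Each \<^term>\<open>brace n A l\<close> lies in this group because fixing
  the row (or column) sums of \<open>A + diag(m)\<close> determines \<open>m\<close> (\<open>brace_carrier\<close>). Hence the span of these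
  elements is a subgroup, and it consists of their finite integral combinations
  (\<open>generate_Khat_int_combination\<close>).

  The substance is linear independence (\<open>brace_independent\<close>). As \<open>A\<close> has zero diagonal, both \<open>A\<close> and
  \<open>m\<close> can be read off from \<open>A + diag(m)\<close>, so the coefficient of \<^term>\<open>brace n A' l'\<close> at \<open>A + diag(m)\<close>
  is the product of binomial coefficients \<open>\<Prod>\<^sub>i (m\<^sub>i choose l'\<^sub>i)\<close> if \<open>A' = A\<close> and zero otherwise
  (\<open>brace_at_add_diag\<close>). At \<open>m = l\<close> this product is one for \<open>l' = l\<close>, and it vanishes unless \<open>l' \<le> l\<close>
  entrywise (\<open>binom_seq_zero\<close>). The coefficients are therefore unitriangular with respect to the
  entrywise order: in a vanishing combination, take an occurring pair \<open>(A, l)\<close> with the sum of the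
  entries of \<open>l\<close> minimal; the coefficient at \<open>A + diag(l)\<close> then only sees the term of \<open>(A, l)\<close>, whose
  scalar must be zero.
\<close>

section \<open>The additive group of formal sums\<close>

lemma Khat_simps:
  "\<zero>\<^bsub>Khat n\<^esub> = (\<lambda>X. 0)"
  "\<beta> \<oplus>\<^bsub>Khat n\<^esub> \<gamma> = (\<lambda>X. \<beta> X + \<gamma> X)"
  by (simp_all add: Khat_def)

lemma Khat_carrier_iff:
  "\<beta> \<in> carrier (Khat n) \<longleftrightarrow> (\<forall>A. \<beta> A \<noteq> 0 \<longrightarrow> A \<in> Theta_tilde n) \<and>
     (\<forall>x \<in> Zseq n. finite {A. \<beta> A \<noteq> 0 \<and> ro A = x} \<and> finite {A. \<beta> A \<noteq> 0 \<and> co A = x})"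
  by (simp add: Khat_def)

lemma Khat_carrier_add:
  assumes "\<beta> \<in> carrier (Khat n)" "\<gamma> \<in> carrier (Khat n)"
  shows "(\<lambda>X. \<beta> X + \<gamma> X) \<in> carrier (Khat n)"
proof -
  have "finite {A. \<beta> A + \<gamma> A \<noteq> 0 \<and> f A = x}"
    if "finite {A. \<beta> A \<noteq> 0 \<and> f A = x}" "finite {A. \<gamma> A \<noteq> 0 \<and> f A = x}"
    for f :: "matrix \<Rightarrow> seq" and x
    by (rule finite_subset[OF _ finite_UnI[OF that]]) auto
  moreover have "A \<in> Theta_tilde n" if "\<beta> A + \<gamma> A \<noteq> 0" for A
    using that assms by (cases "\<beta> A = 0") (auto simp: Khat_carrier_iff)
  ultimately show ?thesis
    using assms by (simp add: Khat_carrier_iff)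
qed

lemma Khat_carrier_uminus:
  "\<beta> \<in> carrier (Khat n) \<Longrightarrow> (\<lambda>X. - \<beta> X) \<in> carrier (Khat n)"
  by (simp add: Khat_carrier_iff)

lemma abelian_group_Khat: "abelian_group (Khat n)"
proof (rule abelian_groupI)
  fix \<beta> assume "\<beta> \<in> carrier (Khat n)"
  then show "\<exists>\<gamma>\<in>carrier (Khat n). \<gamma> \<oplus>\<^bsub>Khat n\<^esub> \<beta> = \<zero>\<^bsub>Khat n\<^esub>"
    by (intro bexI[OF _ Khat_carrier_uminus]) (simp_all add: Khat_simps)
next
  show "\<zero>\<^bsub>Khat n\<^esub> \<in> carrier (Khat n)"
    by (simp add: Khat_simps Khat_carrier_iff)
qed (simp_all add: Khat_simps Khat_carrier_add algebra_simps)

lemma Khat_a_inv: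
  assumes "\<beta> \<in> carrier (Khat n)"
  shows "\<ominus>\<^bsub>Khat n\<^esub> \<beta> = (\<lambda>X. - \<beta> X)"
proof -
  interpret abelian_group "Khat n" by (rule abelian_group_Khat)
  show ?thesis
    using assms by (intro minus_equality) (simp_all add: Khat_simps Khat_carrier_uminus)
qed

lemma Khat_int_multiple:
  fixes k :: int
  assumes "\<beta> \<in> carrier (Khat n)"
  shows "[k] \<cdot>\<^bsub>Khat n\<^esub> \<beta> = (\<lambda>X. of_int k * \<beta> X)"
proof -
  interpret abelian_group "Khat n" by (rule abelian_group_Khat)
  have nat_multiple: "[m] \<cdot>\<^bsub>Khat n\<^esub> \<beta> = (\<lambda>X. of_nat m * \<beta> X)" for m :: nat
    by (induction m) (simp_all add: add_pow_def nat_pow_def Khat_simps algebra_simps)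
  have closed: "[m] \<cdot>\<^bsub>Khat n\<^esub> \<beta> \<in> carrier (Khat n)" for m :: nat
    using assms by simp
  show ?thesis
  proof (cases k)
    case (nonneg m)
    then show ?thesis
      using nat_multiple by (simp add: add_pow_def int_pow_int)
  next
    case (neg m)
    have "[k] \<cdot>\<^bsub>Khat n\<^esub> \<beta> = \<ominus>\<^bsub>Khat n\<^esub> ([Suc m] \<cdot>\<^bsub>Khat n\<^esub> \<beta>)"
      unfolding neg using assms by (rule add.int_pow_neg_int)
    also have "\<dots> = (\<lambda>X. - (of_nat (Suc m) * \<beta> X))"
      using Khat_a_inv[OF closed, of "Suc m"] by (simp only: nat_multiple)
    also have "\<dots> = (\<lambda>X. of_int k * \<beta> X)"
      by (simp add: neg algebra_simps)
    finally show ?thesis .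
  qed
qed

lemma Khat_int_multiple_closed:
  fixes k :: int
  assumes "\<beta> \<in> carrier (Khat n)"
  shows "[k] \<cdot>\<^bsub>Khat n\<^esub> \<beta> \<in> carrier (Khat n)"
proof -
  interpret abelian_group "Khat n" by (rule abelian_group_Khat)
  show ?thesis
    using assms by (rule add.int_pow_closed)
qed

lemma Khat_finsum:
  assumes "finite F" "f \<in> F \<rightarrow> carrier (Khat n)"
  shows "(\<Oplus>\<^bsub>Khat n\<^esub>i\<in>F. f i) = (\<lambda>X. \<Sum>i\<in>F. f i X)"
proof -
  interpret abelian_group "Khat n" by (rule abelian_group_Khat)
  show ?thesis
    using assms by (induction F rule: finite_induct) (simp_all add: Khat_simps Pi_def)
qed

lemma Khat_int_combination:
  fixes c :: "'i \<Rightarrow> int"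
  assumes "finite F" "\<And>i. i \<in> F \<Longrightarrow> b i \<in> carrier (Khat n)"
  shows "(\<Oplus>\<^bsub>Khat n\<^esub>i\<in>F. [c i] \<cdot>\<^bsub>Khat n\<^esub> b i) = (\<lambda>X. \<Sum>i\<in>F. of_int (c i) * b i X)"
proof -
  have "(\<Oplus>\<^bsub>Khat n\<^esub>i\<in>F. [c i] \<cdot>\<^bsub>Khat n\<^esub> b i) = (\<lambda>X. \<Sum>i\<in>F. ([c i] \<cdot>\<^bsub>Khat n\<^esub> b i) X)"
    using assms by (intro Khat_finsum) (auto intro: Khat_int_multiple_closed)
  also have "\<dots> = (\<lambda>X. \<Sum>i\<in>F. of_int (c i) * b i X)"
    using assms(2) by (intro ext sum.cong) (simp_all add: Khat_int_multiple)
  finally show ?thesis .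
qed

section \<open>Subgroups generated by families of formal sums\<close>

lemma generate_Khat_int_combination:
  assumes carr: "\<And>i. i \<in> I \<Longrightarrow> b i \<in> carrier (Khat n)"
    and "v \<in> generate (add_monoid (Khat n)) (b ` I)"
  shows "\<exists>F (c :: 'i \<Rightarrow> int). finite F \<and> F \<subseteq> I \<and>
    v = (\<Oplus>\<^bsub>Khat n\<^esub>i\<in>F. [c i] \<cdot>\<^bsub>Khat n\<^esub> b i)"
proof -
  have "\<exists>F (c :: 'i \<Rightarrow> int). finite F \<and> F \<subseteq> I \<and> v = (\<lambda>X. \<Sum>i\<in>F. of_int (c i) * b i X)"
    using assms(2)
  proof (induction rule: generate.induct)
    case one
    then show ?case
      by (intro exI[of _ "{}"]) (simp add: Khat_simps)
  next
    case (incl h)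
    then obtain i where "i \<in> I" "h = b i" by auto
    then show ?case
      by (intro exI[of _ "{i}"] exI[of _ "\<lambda>_. 1"]) simp
  next
    case (inv h)
    then obtain i where i: "i \<in> I" "h = b i" by auto
    then have "inv\<^bsub>add_monoid (Khat n)\<^esub> h = (\<lambda>X. - b i X)"
      using Khat_a_inv[OF carr[OF i(1)]] by (simp add: a_inv_def)
    with i show ?case
      by (intro exI[of _ "{i}"] exI[of _ "\<lambda>_. - 1"]) simp
  next
    case (eng g h)
    obtain F c where F: "finite F" "F \<subseteq> I" "g = (\<lambda>X. \<Sum>i\<in>F. of_int (c i) * b i X)"
      using eng.IH(1) by auto
    obtain H d where H: "finite H" "H \<subseteq> I" "h = (\<lambda>X. \<Sum>i\<in>H. of_int (d i) * b i X)"
      using eng.IH(2) by auto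
    \<comment> \<open>Extending both families of scalars by zero gives the combinations a common index set.\<close>
    define e where "e = (\<lambda>i. (if i \<in> F then c i else 0) + (if i \<in> H then d i else 0))"
    have "(\<Sum>i\<in>F \<union> H. of_int (e i) * b i X) = g X + h X" for X
    proof -
      have "g X = (\<Sum>i\<in>F \<union> H. of_int (if i \<in> F then c i else 0) * b i X)"
        unfolding F(3) using F(1) H(1) by (intro sum.mono_neutral_cong_left) auto
      moreover have "h X = (\<Sum>i\<in>F \<union> H. of_int (if i \<in> H then d i else 0) * b i X)"
        unfolding H(3) using F(1) H(1) by (intro sum.mono_neutral_cong_left) auto
      ultimately show ?thesis
        unfolding e_def of_int_add distrib_right sum.distrib by simp
    qed
    then show ?case
      using F(1,2) H(1,2)
      by (intro exI[of _ "F \<union> H"] exI[of _ e]) (simp add: Khat_simps)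
  qed
  then obtain F and c :: "'i \<Rightarrow> int" where F: "finite F" "F \<subseteq> I"
    and v: "v = (\<lambda>X. \<Sum>i\<in>F. of_int (c i) * b i X)"
    by auto
  have "v = (\<Oplus>\<^bsub>Khat n\<^esub>i\<in>F. [c i] \<cdot>\<^bsub>Khat n\<^esub> b i)"
    unfolding v using F carr by (intro Khat_int_combination[symmetric]) auto
  with F show ?thesis
    by (intro exI[of _ F] exI[of _ c]) simp
qed

section \<open>Matrices with a fixed off-diagonal part\<close>

lemma ro_add_diag:
  assumes "finite {j. A i j \<noteq> 0}"
  shows "ro (mat_add A (diag_mat m)) i = ro A i + m i"
proof -
  let ?S = "insert i {j. A i j \<noteq> 0}"
  have S: "finite ?S" using assms by simp
  have "ro (mat_add A (diag_mat m)) i = (\<Sum>j\<in>?S. mat_add A (diag_mat m) i j)"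
    unfolding ro_def using S by (intro sum.mono_neutral_left) (auto simp: mat_add_def diag_mat_def)
  also have "\<dots> = (\<Sum>j\<in>?S. A i j) + (\<Sum>j\<in>?S. if i = j then m i else 0)"
    by (simp add: mat_add_def diag_mat_def sum.distrib)
  also have "(\<Sum>j\<in>?S. if i = j then m i else 0) = m i"
    using S by (subst sum.delta') auto
  also have "(\<Sum>j\<in>?S. A i j) = ro A i"
    unfolding ro_def using S by (intro sum.mono_neutral_right) auto
  finally show ?thesis .
qed

lemma co_add_diag:
  assumes "finite {i. A i j \<noteq> 0}"
  shows "co (mat_add A (diag_mat m)) j = co A j + m j"
proof -
  have co_ro: "co C = ro (\<lambda>i j. C j i)" for C
    by (simp add: co_def ro_def)
  have "(\<lambda>i j. mat_add A (diag_mat m) j i) = mat_add (\<lambda>i j. A j i) (diag_mat m)"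
    by (auto simp: mat_add_def diag_mat_def fun_eq_iff)
  then show ?thesis
    using ro_add_diag[of "\<lambda>i j. A j i" j m] assms by (simp add: co_ro)
qed

lemma add_diag_eq_iff:
  assumes "A \<in> Theta_pm n" "A' \<in> Theta_pm n"
  shows "mat_add A' (diag_mat m') = mat_add A (diag_mat m) \<longleftrightarrow> A' = A \<and> m' = m"
proof
  assume "mat_add A' (diag_mat m') = mat_add A (diag_mat m)"
  then have eq: "A' i j + diag_mat m' i j = A i j + diag_mat m i j" for i j
    unfolding mat_add_def by meson
  have "A' i j = A i j" for i j
    using eq[of i j] assms by (cases "i = j") (auto simp: diag_mat_def Theta_pm_def)
  moreover have "m' i = m i" for i
    using eq[of i i] assms by (simp add: diag_mat_def Theta_pm_def)
  ultimately show "A' = A \<and> m' = m" by auto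
qed simp

lemma add_diag_Theta_tilde:
  assumes "A \<in> Theta_pm n" "m \<in> Zseq n"
  shows "mat_add A (diag_mat m) \<in> Theta_tilde n"
proof -
  let ?X = "mat_add A (diag_mat m)"
  have A: "A (i + int n) (j + int n) = A i j" "0 \<le> A i j"
    "finite {j. A i j \<noteq> 0}" "finite {i. A i j \<noteq> 0}" for i j
    using assms(1) by (auto simp: Theta_pm_def Theta_def affine_matrices_def)
  have "finite {j. ?X i j \<noteq> 0}" for i
    by (rule finite_subset[of _ "insert i {j. A i j \<noteq> 0}"])
      (auto simp: A mat_add_def diag_mat_def)
  moreover have "finite {i. ?X i j \<noteq> 0}" for j
    by (rule finite_subset[of _ "insert j {i. A i j \<noteq> 0}"])
      (auto simp: A mat_add_def diag_mat_def)
  ultimately show ?thesis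
    using A(1,2) assms(2)
    by (auto simp: Theta_tilde_def affine_matrices_def mat_add_def diag_mat_def Zseq_def)
qed

section \<open>Coefficients of the spanning elements\<close>

lemma brace_nonzeroE:
  assumes "brace n A l X \<noteq> 0"
  obtains m where "m \<in> Zseq n" "X = mat_add A (diag_mat m)"
proof -
  have "{m. m \<in> Zseq n \<and> mat_add A (diag_mat m) = X} \<noteq> {}"
    using assms unfolding brace_def by (metis sum.empty)
  then show thesis
    using that by auto
qed

lemma brace_at_add_diag:
  assumes "A \<in> Theta_pm n" "A' \<in> Theta_pm n" "m \<in> Zseq n"
  shows "brace n A' l (mat_add A (diag_mat m)) = (if A' = A then binom_seq n m l else 0)"
proof -
  have "{m'. m' \<in> Zseq n \<and> mat_add A' (diag_mat m') = mat_add A (diag_mat m)} =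
      (if A' = A then {m} else {})"
    using assms by (auto simp: add_diag_eq_iff[OF assms(1,2)])
  then show ?thesis
    by (simp add: brace_def)
qed

text \<open>A matrix \<open>A + diag(m)\<close> with prescribed row sums \<open>x\<close> has \<open>m = x - ro(A)\<close>, so at most one matrix
  in the support of \<^term>\<open>brace n A l\<close> has these row sums; likewise for columns.\<close>

lemma brace_carrier:
  assumes "A \<in> Theta_pm n"
  shows "brace n A l \<in> carrier (Khat n)"
proof -
  have fin: "finite {j. A i j \<noteq> 0}" "finite {i. A i j \<noteq> 0}" for i j
    using assms by (auto simp: Theta_pm_def Theta_def affine_matrices_def)
  have ro: "{X. brace n A l X \<noteq> 0 \<and> ro X = x} \<subseteq> {mat_add A (diag_mat (\<lambda>i. x i - ro A i))}" for x
    by (auto elim!: brace_nonzeroE simp: ro_add_diag[OF fin(1)])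
  have co: "{X. brace n A l X \<noteq> 0 \<and> co X = x} \<subseteq> {mat_add A (diag_mat (\<lambda>i. x i - co A i))}" for x
    by (auto elim!: brace_nonzeroE simp: co_add_diag[OF fin(2)])
  have "X \<in> Theta_tilde n" if "brace n A l X \<noteq> 0" for X
    using that by (auto elim!: brace_nonzeroE intro: add_diag_Theta_tilde[OF assms])
  then show ?thesis
    using finite_subset[OF ro] finite_subset[OF co] by (simp add: Khat_carrier_iff)
qed

section \<open>Unitriangularity of the binomial coefficients\<close>

lemma Zseq_eqI:
  assumes "0 < n" "l \<in> Zseq n" "m \<in> Zseq n" "\<And>i. i \<in> {1..int n} \<Longrightarrow> l i = m i"
  shows "l = m"
proof
  fix i
  have per: "f (j + int n * k) = f j" if "f \<in> Zseq n" for f j k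
  proof (induction k rule: int_induct[where k = 0])
    case (step1 k)
    have "f (j + int n * (k + 1)) = f (j + int n * k + int n)" by (simp add: algebra_simps)
    then show ?case using that step1 by (simp add: Zseq_def)
  next
    case (step2 k)
    have "f (j + int n * (k - 1)) = f (j + int n * (k - 1) + int n)" using that by (simp add: Zseq_def)
    then show ?case using step2 by (simp add: algebra_simps)
  qed simp
  define j where "j = (i - 1) mod int n + 1"
  have i: "i = j + int n * ((i - 1) div int n)"
    unfolding j_def using mult_div_mod_eq[of "int n" "i - 1"] by linarith
  have "j \<in> {1..int n}"
    using assms(1) by (simp add: j_def add1_zle_eq)
  then show "l i = m i"
    using per[OF assms(2), of j] per[OF assms(3), of j] assms(4) i by metis
qed

lemma binom_seq_Nseq:
  assumes "m \<in> Nseq n"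
  shows "binom_seq n m l = (\<Prod>i = 1..int n. of_nat (nat (m i) choose nat (l i)))"
proof -
  have "of_int (m i) = (of_nat (nat (m i)) :: rat)" for i
    using assms by (simp add: Nseq_def of_nat_nat)
  then show ?thesis
    by (simp add: binom_seq_def binomial_gbinomial)
qed

lemma binom_seq_self: "l \<in> Nseq n \<Longrightarrow> binom_seq n l l = 1"
  by (simp add: binom_seq_Nseq)

text \<open>If no factor \<open>l\<^sub>i choose l'\<^sub>i\<close> vanishes, then \<open>l' \<le> l\<close> entrywise, and the assumption on the sums
  leaves no room for a strict inequality. Comparing sums instead of entries means that a minimum
  over a finite set can serve as \<open>l\<close>.\<close>

lemma binom_seq_zero:
  assumes "0 < n" "l \<in> Nseq n" "l' \<in> Nseq n" "seq_sum n l \<le> seq_sum n l'" "l' \<noteq> l"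
  shows "binom_seq n l l' = 0"
proof (rule ccontr)
  assume "binom_seq n l l' \<noteq> 0"
  then have choose: "nat (l i) choose nat (l' i) \<noteq> 0" if "i \<in> {1..int n}" for i
    using that assms(2) by (simp add: binom_seq_Nseq)
  have le: "l' i \<le> l i" if "i \<in> {1..int n}" for i
  proof -
    have "0 \<le> l i" using assms(2) by (simp add: Nseq_def)
    then show ?thesis using choose[OF that] by (simp add: not_less) linarith
  qed
  have "(\<Sum>i = 1..int n. l i - l' i) = 0"
    using assms(4) sum_mono[of "{1..int n}" l' l] le by (auto simp: seq_sum_def sum_subtractf)
  then have "l' i = l i" if "i \<in> {1..int n}" for i
    using that le by (subst (asm) sum_nonneg_eq_0_iff) auto
  then have "l' = l"
    using assms by (intro Zseq_eqI[of n]) (auto simp: Nseq_def)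
  with assms(5) show False by simp
qed

text \<open>Elimination along the unitriangular coefficients: for an occurring pair \<open>(A, l)\<close> with minimal
  sum of \<open>l\<close>, all other terms vanish at the matrix \<open>A + diag(l)\<close>.\<close>

lemma brace_independent:
  fixes c :: "matrix \<times> seq \<Rightarrow> int"
  assumes "0 < n" "finite F" "F \<subseteq> Theta_pm n \<times> Nseq n"
    and zero: "\<And>X. (\<Sum>(A, l)\<in>F. of_int (c (A, l)) * brace n A l X) = 0"
    and "p \<in> F"
  shows "c p = 0"
proof (rule ccontr)
  assume "c p \<noteq> 0"
  with \<open>p \<in> F\<close> have "\<exists>q. (q \<in> F \<and> c q \<noteq> 0) \<and>
      (\<forall>q'. q' \<in> F \<and> c q' \<noteq> 0 \<longrightarrow> nat (seq_sum n (snd q)) \<le> nat (seq_sum n (snd q')))"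
    by (intro ex_has_least_nat[where k = p]) simp
  then obtain A l where Al: "(A, l) \<in> F" "c (A, l) \<noteq> 0"
    and least: "\<And>A' l'. (A', l') \<in> F \<Longrightarrow> c (A', l') \<noteq> 0 \<Longrightarrow> nat (seq_sum n l) \<le> nat (seq_sum n l')"
    by fastforce
  have A: "A \<in> Theta_pm n" and l: "l \<in> Nseq n" "l \<in> Zseq n"
    using Al(1) assms(3) by (auto simp: Nseq_def)
  let ?X = "mat_add A (diag_mat l)"
  have vanish: "of_int (c (A', l')) * brace n A' l' ?X = 0"
    if "(A', l') \<in> F" "(A', l') \<noteq> (A, l)" for A' l'
  proof (cases "A' = A \<and> c (A', l') \<noteq> 0")
    case True
    have l': "l' \<in> Nseq n" using that assms(3) by auto
    have "0 \<le> seq_sum n l'"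
      using l' by (auto simp: seq_sum_def Nseq_def intro!: sum_nonneg)
    then have "seq_sum n l \<le> seq_sum n l'"
      using least[OF that(1)] True by (metis nat_le_eq_zle)
    then have "binom_seq n l l' = 0"
      using that True l l' assms(1) by (intro binom_seq_zero) auto
    then show ?thesis
      using brace_at_add_diag[OF A A l(2)] True by simp
  next
    case False
    then show ?thesis
      using brace_at_add_diag[OF A _ l(2), of A' l'] that assms(3) by (cases "A' = A") auto
  qed
  have "0 = (\<Sum>(A', l')\<in>F. of_int (c (A', l')) * brace n A' l' ?X)"
    by (simp only: zero)
  also have "\<dots> = (\<Sum>(A', l')\<in>{(A, l)}. of_int (c (A', l')) * brace n A' l' ?X)"
  proof (rule sum.mono_neutral_right)
    show "\<forall>q\<in>F - {(A, l)}. (case q of (A', l') \<Rightarrow> of_int (c (A', l')) * brace n A' l' ?X) = 0"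
    proof
      fix q assume "q \<in> F - {(A, l)}"
      then show "(case q of (A', l') \<Rightarrow> of_int (c (A', l')) * brace n A' l' ?X) = 0"
        using vanish[of "fst q" "snd q"] by (simp only: case_prod_beta prod.collapse) simp
    qed
  qed (use assms(2) Al(1) in auto)
  also have "\<dots> = of_int (c (A, l))"
    using brace_at_add_diag[OF A A l(2), of l] l(1) by (simp add: binom_seq_self)
  finally show False
    using Al(2) by simp
qed

section \<open>The integral basis\<close>

theorem lemma8p1:
  fixes n :: nat
  assumes "2 \<le> n"
  shows "subgroup (V_Z n) (add_monoid (Khat n)) \<and>
    Z_basis (Khat n) (\<lambda>(A, l). brace n A l) (Theta_pm n \<times> Nseq n) (V_Z n)"
proof -
  interpret abelian_group "Khat n" by (rule abelian_group_Khat)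
  let ?I = "Theta_pm n \<times> Nseq n" and ?b = "\<lambda>(A, l). brace n A l"
  have carr: "?b p \<in> carrier (Khat n)" if "p \<in> ?I" for p
    using that by (auto intro: brace_carrier)
  have B: "B_set n = ?b ` ?I"
    by (force simp: B_set_def)
  have "B_set n \<subseteq> carrier (add_monoid (Khat n))"
    unfolding B using carr by auto
  then have subgr: "subgroup (V_Z n) (add_monoid (Khat n))"
    unfolding V_Z_def by (intro add.generate_is_subgroup) simp
  have member: "?b \<in> ?I \<rightarrow> V_Z n"
    by (auto simp: V_Z_def B_set_def intro!: generate.incl)
  have indep: "\<forall>p\<in>F. c p = 0"
    if F: "finite F" "F \<subseteq> ?I" and zero: "(\<Oplus>\<^bsub>Khat n\<^esub>p\<in>F. [c p] \<cdot>\<^bsub>Khat n\<^esub> ?b p) = \<zero>\<^bsub>Khat n\<^esub>"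
    for F and c :: "matrix \<times> seq \<Rightarrow> int"
  proof -
    have "(\<lambda>X. \<Sum>p\<in>F. of_int (c p) * ?b p X) = (\<lambda>X. 0)"
      using zero Khat_int_combination[OF F(1), of ?b n c] F(2) carr
      by (auto simp: Khat_simps subset_iff)
    then have "(\<Sum>(A, l)\<in>F. of_int (c (A, l)) * brace n A l X) = 0" for X
      by (simp add: fun_eq_iff case_prod_beta)
    then show ?thesis
      using brace_independent[OF _ F] assms by auto
  qed
  have span: "\<exists>F (c :: matrix \<times> seq \<Rightarrow> int). finite F \<and> F \<subseteq> ?I \<and>
      v = (\<Oplus>\<^bsub>Khat n\<^esub>p\<in>F. [c p] \<cdot>\<^bsub>Khat n\<^esub> ?b p)" if "v \<in> V_Z n" for v
    using that generate_Khat_int_combination[of ?I ?b n v] carr unfolding V_Z_def B by blast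
  show ?thesis
    unfolding Z_basis_def
  proof (intro conjI)
    show "\<forall>F (c :: matrix \<times> seq \<Rightarrow> int). finite F \<and> F \<subseteq> ?I \<and>
        (\<Oplus>\<^bsub>Khat n\<^esub>p\<in>F. [c p] \<cdot>\<^bsub>Khat n\<^esub> ?b p) = \<zero>\<^bsub>Khat n\<^esub> \<longrightarrow> (\<forall>p\<in>F. c p = 0)"
      by (intro allI impI, elim conjE) (rule indep)
    show "\<forall>v\<in>V_Z n. \<exists>F (c :: matrix \<times> seq \<Rightarrow> int). finite F \<and> F \<subseteq> ?I \<and>
        v = (\<Oplus>\<^bsub>Khat n\<^esub>p\<in>F. [c p] \<cdot>\<^bsub>Khat n\<^esub> ?b p)"
      by (intro ballI) (rule span)
  qed (fact subgr member)+
qed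

end
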